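(* Let $R$ be a Dedekind domain and let $I$ be a nonzero ideal of $R$ such that $R/I$ is finite and nontrivial. If $I$ is a prime ideal, then $\gamma_{cl}(G_{R/I})=1$. If $I$ is not prime and $Q(I)>\lambda(I)$, then $\gamma_{cl}(G_{R/I})=\lambda(I)+1$. If $I$ is not prime and $Q(I)\le\lambda(I)$, then $\gamma_{cl}(G_{R/I})$ does not exist (no clique of $G_{R/I}$ dominates $G_{R/I}$). Furthermore, if $\gamma_{cl}(G_{R/I})$ exists, then every clique of $G_{R/I}$ of order $\gamma_{cl}(G_{R/I})$ dominates $G_{R/I}$.
   Context: $G_{R/I}$ is the unitary Cayley graph of $R/I$: vertex set $R/I$, with $a+I$, $b+I$ adjacent iff $a-b+I$ is a unit of $R/I$. $Q(I)$ is the minimum of $|R/P|$ over all prime ideals $P$ dividing $I$, and $\lambda(I)$ is the number of distinct prime ideal divisors of $I$. A set $D$ of vertices dominates $G$ if every vertex is in $D$ or adjacent to some element of $D$. The clique domination number $\gamma_{cl}(G)$ is the smallest order of a clique of $G$ that dominates $G$, if some dominating clique exists. *)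

theory Defs
  imports "HOL-Algebra.Algebra" "Graph_Theory.Pair_Digraph"
begin

text \<open>
  A Dedekind domain is an integral domain in which every nonzero proper ideal is a product of
  prime ideals. (Uniqueness of the factorization is a consequence.)
\<close>

locale dedekind_domain = domain R for R (structure) +
  assumes prime_factorization:
    "\<lbrakk> ideal I R; I \<noteq> {\<zero>}; I \<noteq> carrier R \<rbrakk> \<Longrightarrow>
       \<exists>Ps. (\<forall>P\<in>set Ps. primeideal P R) \<and> I = foldr (ideal_prod R) Ps (carrier R)"

definition ideal_divides :: "('a, 'b) ring_scheme \<Rightarrow> 'a set \<Rightarrow> 'a set \<Rightarrow> bool" where
  "ideal_divides R P I \<longleftrightarrow> (\<exists>J. ideal J R \<and> I = ideal_prod R P J)"

definition prime_divisors :: "('a, 'b) ring_scheme \<Rightarrow> 'a set \<Rightarrow> 'a set set" where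
  "prime_divisors R I = {P. primeideal P R \<and> ideal_divides R P I}"

definition lam :: "('a, 'b) ring_scheme \<Rightarrow> 'a set \<Rightarrow> nat" where
  "lam R I = card (prime_divisors R I)"

text \<open>
  For \<open>R/I\<close> finite and nontrivial, \<open>I\<close> has at least one and only finitely many prime divisors
  \<open>P\<close>, and each \<open>R/P\<close> is finite.
\<close>

definition Q :: "('a, 'b) ring_scheme \<Rightarrow> 'a set \<Rightarrow> nat" where
  "Q R I = Min ((\<lambda>P. card (carrier (R Quot P))) ` prime_divisors R I)"

text \<open>
  Simple graphs are represented as symmetric loop-free digraphs, see \<open>pair_graph\<close>. The notions
  below are meant for these; in particular all graphs are finite.
\<close>

definition clique :: "'v pair_pre_digraph \<Rightarrow> 'v set \<Rightarrow> bool" where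
  "clique G K \<longleftrightarrow> K \<subseteq> pverts G \<and> (\<forall>u\<in>K. \<forall>v\<in>K. u \<noteq> v \<longrightarrow> (u, v) \<in> parcs G)"

definition dominating :: "'v pair_pre_digraph \<Rightarrow> 'v set \<Rightarrow> bool" where
  "dominating G D \<longleftrightarrow>
     D \<subseteq> pverts G \<and> (\<forall>v\<in>pverts G. v \<in> D \<or> (\<exists>u\<in>D. (v, u) \<in> parcs G))"

text \<open>The value \<open>None\<close> means that the clique domination number does not exist.\<close>

definition clique_domination_number :: "'v pair_pre_digraph \<Rightarrow> nat option" where
  "clique_domination_number G =
     (if \<exists>K. clique G K \<and> dominating G K
      then Some (LEAST k. \<exists>K. clique G K \<and> dominating G K \<and> card K = k)
      else None)"

definition unitary_cayley_graph :: "('a, 'b) ring_scheme \<Rightarrow> 'a pair_pre_digraph" where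
  "unitary_cayley_graph S =
     \<lparr> pverts = carrier S,
       parcs = {(x, y). x \<in> carrier S \<and> y \<in> carrier S \<and> x \<ominus>\<^bsub>S\<^esub> y \<in> Units S} \<rparr>"

lemma pair_graph_unitary_cayley_graph:
  assumes "cring S" and "finite (carrier S)" and "carrier S \<noteq> {\<zero>\<^bsub>S\<^esub>}"
  shows "pair_graph (unitary_cayley_graph S)"
proof -
  interpret cring S by fact
  have one: "\<one>\<^bsub>S\<^esub> \<noteq> \<zero>\<^bsub>S\<^esub>"
    using assms(3) one_zeroD by blast
  have minus_swap: "y \<ominus>\<^bsub>S\<^esub> x = \<ominus>\<^bsub>S\<^esub> (x \<ominus>\<^bsub>S\<^esub> y)"
    if "x \<in> carrier S" "y \<in> carrier S" for x y
    using that by (simp add: a_minus_def minus_add a_comm)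
  have neg_unit: "\<ominus>\<^bsub>S\<^esub> u \<in> Units S" if "u \<in> Units S" for u
  proof -
    have "(\<ominus>\<^bsub>S\<^esub> u) \<otimes>\<^bsub>S\<^esub> (\<ominus>\<^bsub>S\<^esub> (inv\<^bsub>S\<^esub> u)) = \<one>\<^bsub>S\<^esub>"
      using that by (simp add: l_minus r_minus Units_closed)
    moreover have "(\<ominus>\<^bsub>S\<^esub> (inv\<^bsub>S\<^esub> u)) \<otimes>\<^bsub>S\<^esub> (\<ominus>\<^bsub>S\<^esub> u) = \<one>\<^bsub>S\<^esub>"
      using that by (simp add: l_minus r_minus Units_closed)
    ultimately show ?thesis
      using that Units_closed[OF that] Units_inv_closed[OF that] unfolding Units_def[of S] by fast
  qed
  have zero: "\<zero>\<^bsub>S\<^esub> \<notin> Units S"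
    using one by (metis Units_r_inv Units_inv_closed l_null)
  show ?thesis
  proof unfold_locales
    show "finite (parcs (unitary_cayley_graph S))"
      by (rule finite_subset[of _ "carrier S \<times> carrier S"])
        (auto simp: unitary_cayley_graph_def assms(2))
  next
    show "symmetric (with_proj (unitary_cayley_graph S))"
      unfolding symmetric_def sym_def
      by (auto simp: unitary_cayley_graph_def) (metis minus_swap neg_unit)
  qed (use zero assms(2) in \<open>auto simp: unitary_cayley_graph_def a_minus_def r_neg\<close>)
qed

end

theory Submission
  imports Defs
begin

text \<open>
  Let \<open>I\<close> be proper with \<open>R/I\<close> finite. Every prime divisor \<open>P\<close> of \<open>I\<close> is maximal, since \<open>R/P\<close> is
  a finite domain, and an element is a unit modulo \<open>I\<close> iff it lies in no prime divisor. Hence two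
  vertices are adjacent iff they differ modulo every prime divisor, so the elements of a clique
  have distinct residues modulo each \<open>P\<close>. The Chinese remainder theorem makes the residues
  independent. If a clique \<open>K\<close> has at most \<open>\<lambda>(I)\<close> elements, then a vertex agreeing with each
  element of \<open>K\<close> modulo some prime divisor is adjacent to none of them; it can be chosen outside
  \<open>K\<close>, which for singletons requires that \<open>I\<close> is not prime. By the pigeonhole principle, a clique
  with more than \<open>\<lambda>(I)\<close> elements dominates. Such a clique exists iff every residue field has more
  than \<open>\<lambda>(I)\<close> elements.
\<close>

section \<open>Graphs with independent coordinates\<close>

text \<open>Abstracts the Cayley graph: the vertices are cosets of \<open>I\<close>,
  \<open>\<Lambda>\<close> is the set of prime divisors, and \<open>f P\<close> reduces modulo
  \<open>P\<close>. The assumption \<open>independent\<close> is the Chinese remainder theorem; each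
  prescribed value is the coordinate of some vertex \<open>c i\<close>, so only values that occur
  are prescribed.\<close>

locale coordinate_graph =
  fixes G :: "'v pair_pre_digraph" and \<Lambda> :: "'i set" and f :: "'i \<Rightarrow> 'v \<Rightarrow> 'c"
  assumes finite_verts: "finite (pverts G)"
    and verts_ne: "pverts G \<noteq> {}"
    and finite_coords: "finite \<Lambda>"
    and coords_ne: "\<Lambda> \<noteq> {}"
    and arcs_iff: "\<lbrakk>u \<in> pverts G; v \<in> pverts G\<rbrakk> \<Longrightarrow>
      (u, v) \<in> parcs G \<longleftrightarrow> (\<forall>i\<in>\<Lambda>. f i u \<noteq> f i v)"
    and independent: "(\<And>i. i \<in> \<Lambda> \<Longrightarrow> c i \<in> pverts G) \<Longrightarrow>
      \<exists>v\<in>pverts G. \<forall>i\<in>\<Lambda>. f i v = f i (c i)"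
begin

lemma clique_finite: "clique G K \<Longrightarrow> finite K"
  using finite_subset[OF _ finite_verts] by (auto simp: clique_def)

lemma clique_inj_on:
  assumes "clique G K" "i \<in> \<Lambda>"
  shows "inj_on (f i) K"
proof (rule inj_onI, rule ccontr)
  fix u v assume uv: "u \<in> K" "v \<in> K" "f i u = f i v" "u \<noteq> v"
  then have "(u, v) \<in> parcs G" "u \<in> pverts G" "v \<in> pverts G"
    using assms(1) by (auto simp: clique_def)
  then show False
    using arcs_iff uv(3) assms(2) by blast
qed

lemma clique_card_le:
  assumes "clique G K" "i \<in> \<Lambda>"
  shows "card K \<le> card (f i ` pverts G)"
  using clique_inj_on[OF assms] assms(1) finite_verts
  by (metis card_image card_mono clique_def finite_imageI image_mono)

text \<open>A vertex \<open>v\<close> without a neighbour in \<open>K\<close> shares a coordinate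
  with each element of \<open>K\<close>. By pigeonhole two elements of \<open>K\<close> share the
  same coordinate with \<open>v\<close>, so they agree there, against
  \<open>clique_inj_on\<close>.\<close>

lemma clique_card_gt_dominating:
  assumes "clique G K" "card K > card \<Lambda>"
  shows "dominating G K"
proof -
  have sub: "K \<subseteq> pverts G"
    using assms(1) by (simp add: clique_def)
  have "\<exists>u\<in>K. (v, u) \<in> parcs G" if v: "v \<in> pverts G" for v
  proof (rule ccontr)
    assume "\<not> ?thesis"
    then have "\<forall>u\<in>K. \<exists>i. i \<in> \<Lambda> \<and> f i v = f i u"
      using arcs_iff v sub by blast
    from bchoice[OF this] obtain g where g: "\<forall>u\<in>K. g u \<in> \<Lambda> \<and> f (g u) v = f (g u) u" ..
    note g = bspec[OF g, THEN conjunct1] bspec[OF g, THEN conjunct2]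
    have "\<not> inj_on g K"
    proof
      assume "inj_on g K"
      moreover have "g ` K \<subseteq> \<Lambda>"
        using g(1) by blast
      ultimately show False
        using card_inj_on_le[OF _ _ finite_coords] assms(2) by (meson not_less)
    qed
    then obtain u w where "u \<in> K" "w \<in> K" "u \<noteq> w" "g u = g w"
      by (auto simp: inj_on_def)
    then show False
      using inj_onD[OF clique_inj_on[OF assms(1) g(1)]] g(2) by metis
  qed
  then show ?thesis
    using sub by (auto simp: dominating_def)
qed

text \<open>The hypothesis \<open>agree\<close> enters only when \<open>K\<close> is a singleton; in
  the application it follows from \<open>I\<close> not being prime.\<close>

lemma dominating_clique_card_gt:
  assumes agree: "\<And>v. v \<in> pverts G \<Longrightarrow> \<exists>w\<in>pverts G. w \<noteq> v \<and> (\<exists>i\<in>\<Lambda>. f i w = f i v)"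
    and "clique G K" "dominating G K"
  shows "card K > card \<Lambda>"
proof (rule ccontr)
  assume "\<not> card K > card \<Lambda>"
  then have le: "card K \<le> card \<Lambda>" by simp
  have sub: "K \<subseteq> pverts G" and fin: "finite K"
    using assms(2) clique_finite by (auto simp: clique_def)
  have ne: "K \<noteq> {}"
    using assms(3) verts_ne by (auto simp: dominating_def)
  obtain h where h: "h ` K \<subseteq> \<Lambda>" "inj_on h K"
    using le fin finite_coords card_le_inj by blast
  \<comment> \<open>A coordinate assigned by \<open>h\<close> copies the element of \<open>K\<close>
    it belongs to; all other coordinates copy an arbitrary element of \<open>K\<close>.\<close>
  define c where "c i = (if i \<in> h ` K then the_inv_into K h i else (SOME u. u \<in> K))" for i
  have c: "c i \<in> K" for i
    using ne h(2) by (auto simp: c_def the_inv_into_f_f some_in_eq)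
  have ch: "c (h u) = u" if "u \<in> K" for u
    using that h(2) by (auto simp: c_def the_inv_into_f_f)
  obtain v where v: "v \<in> pverts G" "\<forall>i\<in>\<Lambda>. f i v = f i (c i)"
    using independent[of c] c sub by blast
  have meets: "f (h u) v = f (h u) u" if "u \<in> K" for u
    using v(2) h(1) ch that by fastforce
  show False
  proof (cases "v \<in> K")
    case False
    then obtain u where "u \<in> K" "(v, u) \<in> parcs G"
      using assms(3) v(1) by (auto simp: dominating_def)
    then show False
      using arcs_iff[OF v(1)] meets h(1) sub by blast
  next
    case True
    \<comment> \<open>Both \<open>u\<close> and \<open>v\<close> lie in the clique \<open>K\<close>
      and share the coordinate \<open>h u\<close>, which is injective on \<open>K\<close>.\<close>
    have "u = v" if "u \<in> K" for u
      using inj_onD[OF clique_inj_on[OF assms(2), of "h u"] meets[OF that, symmetric] that True]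
        h(1) that by blast
    then have "K = {v}"
      using True by blast
    \<comment> \<open>Since \<open>w\<close> is outside \<open>K\<close>, domination makes it
      adjacent to \<open>v\<close>, although the two share a coordinate.\<close>
    obtain w i where w: "w \<in> pverts G" "w \<noteq> v" "i \<in> \<Lambda>" "f i w = f i v"
      using agree v(1) by blast
    then have "(w, v) \<in> parcs G"
      using assms(3) \<open>K = {v}\<close> by (auto simp: dominating_def)
    then show False
      using arcs_iff w v(1) by blast
  qed
qed

text \<open>For each coordinate choose \<open>n\<close> vertices with distinct values there, then
  glue the \<open>k\<close>-th choices of all coordinates into one vertex \<open>w k\<close>.
  Different indices then give vertices that differ in every coordinate.\<close>

lemma clique_exists:
  assumes "\<And>i. i \<in> \<Lambda> \<Longrightarrow> n \<le> card (f i ` pverts G)"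
  shows "\<exists>K. clique G K \<and> card K = n"
proof -
  have "\<exists>g. (\<forall>k<n. g k \<in> pverts G) \<and> inj_on (\<lambda>k. f i (g k)) {..<n}" if i: "i \<in> \<Lambda>" for i
  proof -
    obtain h where h: "h ` {..<n} \<subseteq> f i ` pverts G" "inj_on h {..<n}"
      using card_le_inj[of "{..<n}" "f i ` pverts G"] assms[OF i] finite_verts by auto
    then have "\<forall>k\<in>{..<n}. \<exists>v\<in>pverts G. f i v = h k"
      by (force simp: image_subset_iff)
    then obtain g where g: "\<forall>k\<in>{..<n}. g k \<in> pverts G \<and> f i (g k) = h k"
      by metis
    then have "inj_on (\<lambda>k. f i (g k)) {..<n}"
      using h(2) by (simp add: inj_on_def)
    with g show ?thesis by auto
  qed
  then obtain g where g: "\<And>i k. \<lbrakk>i \<in> \<Lambda>; k < n\<rbrakk> \<Longrightarrow> g i k \<in> pverts G"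
    and g_inj: "\<And>i. i \<in> \<Lambda> \<Longrightarrow> inj_on (\<lambda>k. f i (g i k)) {..<n}"
    by metis
  have "\<forall>k\<in>{..<n}. \<exists>v\<in>pverts G. \<forall>i\<in>\<Lambda>. f i v = f i (g i k)"
    using independent g by auto
  then obtain w where w: "\<And>k. k < n \<Longrightarrow> w k \<in> pverts G"
    "\<And>k i. \<lbrakk>k < n; i \<in> \<Lambda>\<rbrakk> \<Longrightarrow> f i (w k) = f i (g i k)"
    by (metis lessThan_iff)
  have w_inj: "inj_on (\<lambda>k. f i (w k)) {..<n}" if "i \<in> \<Lambda>" for i
    using g_inj[OF that] w(2) that by (simp add: inj_on_def)
  have "clique G (w ` {..<n})"
    unfolding clique_def
  proof (intro conjI ballI impI)
    fix u v assume "u \<in> w ` {..<n}" "v \<in> w ` {..<n}" "u \<noteq> v"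
    then obtain k l where "k < n" "l < n" "u = w k" "v = w l" "k \<noteq> l" by auto
    then show "(u, v) \<in> parcs G"
      using arcs_iff w(1) w_inj by (auto simp: inj_on_def)
  qed (use w(1) in auto)
  \<comment> \<open>Distinctness of the vertices \<open>w k\<close> is read off at a single
    coordinate, which exists by \<open>coords_ne\<close>.\<close>
  moreover have "inj_on w {..<n}"
    using w_inj coords_ne inj_on_imageI2[of _ w] by (fastforce simp: comp_def)
  ultimately show ?thesis
    by (metis card_image card_lessThan)
qed

lemma clique_domination_number_Some:
  assumes "\<And>v. v \<in> pverts G \<Longrightarrow> \<exists>w\<in>pverts G. w \<noteq> v \<and> (\<exists>i\<in>\<Lambda>. f i w = f i v)"
    and "\<And>i. i \<in> \<Lambda> \<Longrightarrow> card \<Lambda> < card (f i ` pverts G)"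
  shows "clique_domination_number G = Some (card \<Lambda> + 1)"
proof -
  obtain K where K: "clique G K" "card K = card \<Lambda> + 1"
    using clique_exists[of "card \<Lambda> + 1"] assms(2) by force
  then have dom: "dominating G K"
    using clique_card_gt_dominating by simp
  have "(LEAST k. \<exists>K. clique G K \<and> dominating G K \<and> card K = k) = card \<Lambda> + 1"
    using K dom dominating_clique_card_gt[OF assms(1)] by (intro Least_equality) fastforce+
  then show ?thesis
    using K dom by (auto simp: clique_domination_number_def)
qed

text \<open>A coordinate with at most \<open>card \<Lambda>\<close> values bounds every clique by
  \<open>card \<Lambda>\<close>, a size that a dominating clique must exceed.\<close>

lemma clique_domination_number_None:
  assumes "\<And>v. v \<in> pverts G \<Longrightarrow> \<exists>w\<in>pverts G. w \<noteq> v \<and> (\<exists>i\<in>\<Lambda>. f i w = f i v)"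
    and "i \<in> \<Lambda>" "card (f i ` pverts G) \<le> card \<Lambda>"
  shows "clique_domination_number G = None"
  using dominating_clique_card_gt[OF assms(1)] clique_card_le[OF _ assms(2)] assms(3)
  unfolding clique_domination_number_def by fastforce

end

section \<open>Complete graphs\<close>

lemma complete_graph_dominating:
  assumes "clique G (pverts G)" "D \<subseteq> pverts G" "D \<noteq> {}"
  shows "dominating G D"
  using assms by (force simp: clique_def dominating_def)

lemma complete_graph_clique_domination_number:
  assumes "clique G (pverts G)" "pverts G \<noteq> {}" "finite (pverts G)"
  shows "clique_domination_number G = Some 1"
proof -
  obtain v where v: "v \<in> pverts G"
    using assms(2) by blast
  have cl: "clique G {v}" "dominating G {v}"
    using v complete_graph_dominating[OF assms(1)] by (auto simp: clique_def)
  have "(LEAST k. \<exists>K. clique G K \<and> dominating G K \<and> card K = k) = 1"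
  proof (rule Least_equality)
    fix k assume "\<exists>K. clique G K \<and> dominating G K \<and> card K = k"
    then obtain K where K: "clique G K" "dominating G K" "card K = k" by blast
    have "K \<noteq> {}" "finite K"
      using K v finite_subset[OF _ assms(3)] by (auto simp: clique_def dominating_def)
    then show "1 \<le> k"
      using K(3) by (auto simp: Suc_le_eq card_gt_0_iff)
  qed (use cl in \<open>auto intro!: exI[of _ "{v}"]\<close>)
  then show ?thesis
    using cl unfolding clique_domination_number_def by auto
qed

section \<open>Prime divisors of an ideal with finite quotient\<close>

text \<open>Multiplication by \<open>a\<close> is injective, hence onto the finite carrier, and so
  it hits \<open>\<one>\<close>.\<close>

lemma (in domain) finite_right_inverse:
  assumes "finite (carrier R)" "a \<in> carrier R" "a \<noteq> \<zero>"
  shows "\<exists>b\<in>carrier R. a \<otimes> b = \<one>"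
proof -
  have "inj_on ((\<otimes>) a) (carrier R)"
    using assms(2,3) by (auto simp: inj_on_def m_lcancel)
  then have "(\<otimes>) a ` carrier R = carrier R"
    using assms by (intro endo_inj_surj) auto
  then show ?thesis
    using one_closed by (metis imageE)
qed

lemma carrier_Quot: "carrier (R Quot I) = (\<lambda>x. I +>\<^bsub>R\<^esub> x) ` carrier R"
  by (auto simp: FactRing_simps)

lemma (in cring) coset_eq_zero_iff:
  assumes "ideal I R" "x \<in> carrier R"
  shows "I +> x = I \<longleftrightarrow> x \<in> I"
  using assms ideal.rcos_const_imp_mem a_rcos_zero by metis

text \<open>Turns invertibility in the quotient into an equation in \<open>R\<close>, which carries
  over to larger ideals and can be multiplied over several ideals.\<close>

lemma (in cring) unit_mod_iff:
  assumes J: "ideal J R" and d: "d \<in> carrier R"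
  shows "J +> d \<in> Units (R Quot J) \<longleftrightarrow> (\<exists>e\<in>carrier R. \<exists>z\<in>J. d \<otimes> e \<oplus> z = \<one>)"
proof -
  interpret J: ideal J R by fact
  interpret Q: cring "R Quot J" by (rule J.quotient_is_cring[OF is_cring])
  interpret h: ring_hom_cring R "R Quot J" "(+>) J" by (rule J.rcos_ring_hom_cring[OF is_cring])
  have "J +> d \<in> Units (R Quot J) \<longleftrightarrow>
      (\<exists>A\<in>carrier (R Quot J). (J +> d) \<otimes>\<^bsub>R Quot J\<^esub> A = \<one>\<^bsub>R Quot J\<^esub>)"
    using d h.hom_closed Q.m_comm unfolding Units_def by fastforce
  also have "\<dots> \<longleftrightarrow> (\<exists>e\<in>carrier R. J +> (d \<otimes> e) = J +> \<one>)"
    using d by (simp add: carrier_Quot)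
  also have "\<dots> \<longleftrightarrow> (\<exists>e\<in>carrier R. \<one> \<ominus> d \<otimes> e \<in> J)"
    using d quotient_eq_iff_same_a_r_cos[OF J] by (metis m_closed one_closed)
  also have "\<dots> \<longleftrightarrow> (\<exists>e\<in>carrier R. \<exists>z\<in>J. d \<otimes> e \<oplus> z = \<one>)"
  proof (intro bex_cong refl)
    fix e assume e: "e \<in> carrier R"
    have "d \<otimes> e \<oplus> (\<one> \<ominus> d \<otimes> e) = \<one>"
      using d e by algebra
    moreover have "z = \<one> \<ominus> d \<otimes> e" if "z \<in> J" "d \<otimes> e \<oplus> z = \<one>" for z
    proof -
      have "z = (d \<otimes> e \<oplus> z) \<ominus> d \<otimes> e"
        using d e J.Icarr[OF that(1)] by algebra
      then show ?thesis
        using that(2) by simp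
    qed
    ultimately show "\<one> \<ominus> d \<otimes> e \<in> J \<longleftrightarrow> (\<exists>z\<in>J. d \<otimes> e \<oplus> z = \<one>)"
      by metis
  qed
  finally show ?thesis .
qed

lemma (in cring) prime_unit_mod:
  assumes "primeideal P R" "finite (carrier (R Quot P))" "d \<in> carrier R" "d \<notin> P"
  shows "\<exists>e\<in>carrier R. \<exists>z\<in>P. d \<otimes> e \<oplus> z = \<one>"
proof -
  interpret P: primeideal P R by fact
  interpret Q: "domain" "R Quot P" by (rule P.quotient_is_domain)
  have closed: "P +> d \<in> carrier (R Quot P)"
    using assms(3) by (simp add: carrier_Quot)
  have "P +> d \<noteq> \<zero>\<^bsub>R Quot P\<^esub>"
    using assms(3,4) coset_eq_zero_iff[OF P.is_ideal] by (simp add: FactRing_def)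
  then obtain A where "A \<in> carrier (R Quot P)" "(P +> d) \<otimes>\<^bsub>R Quot P\<^esub> A = \<one>\<^bsub>R Quot P\<^esub>"
    using Q.finite_right_inverse[OF assms(2) closed] by blast
  then have "P +> d \<in> Units (R Quot P)"
    using closed Q.m_comm unfolding Units_def by fastforce
  then show ?thesis
    using unit_mod_iff[OF P.is_ideal assms(3)] by simp
qed

text \<open>If \<open>J\<close> contains some \<open>d\<close> outside \<open>P\<close>, inverting
  \<open>d\<close> modulo \<open>P\<close> writes \<open>\<one>\<close> as a multiple of
  \<open>d\<close> plus an element of \<open>P\<close>, so \<open>\<one>\<close> lies in
  \<open>J\<close>.\<close>

lemma (in cring) finite_Quot_prime_maximal:
  assumes "primeideal P R" "finite (carrier (R Quot P))"
  shows "maximalideal P R"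
proof -
  interpret P: primeideal P R by fact
  show ?thesis
  proof (rule maximalidealI)
    fix J assume J: "ideal J R" "P \<subseteq> J" "J \<subseteq> carrier R"
    interpret J: ideal J R by fact
    show "J = P \<or> J = carrier R"
    proof (cases "J = P")
      case False
      then obtain d where d: "d \<in> J" "d \<notin> P"
        using J(2) by blast
      then obtain e z where "e \<in> carrier R" "z \<in> P" "d \<otimes> e \<oplus> z = \<one>"
        using prime_unit_mod[OF assms] J.Icarr by blast
      then have "\<one> \<in> J"
        using d(1) J(2) by (metis J.I_r_closed J.a_closed subsetD)
      then show ?thesis
        using J.one_imp_carrier by blast
    qed simp
  qed (use P.is_ideal P.I_notcarr in auto)
qed

section \<open>Comaximality and the Chinese remainder theorem\<close>

text \<open>The sum is an ideal containing both; if it were proper, maximality would make it equal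
  to \<open>P\<close> and to \<open>P'\<close>.\<close>

lemma (in cring) maximal_ideals_sum:
  assumes "maximalideal P R" "maximalideal P' R" "P \<noteq> P'"
  shows "P <+> P' = carrier R"
proof -
  interpret P: maximalideal P R by fact
  interpret P': maximalideal P' R by fact
  have J: "ideal (P <+> P') R"
    by (rule add_ideals[OF P.is_ideal P'.is_ideal])
  have sub: "P <+> P' \<subseteq> carrier R"
    by (rule set_add_closed[OF P.a_subset P'.a_subset])
  have "P \<subseteq> P <+> P'"
  proof
    fix p assume p: "p \<in> P"
    then have "p = p \<oplus> \<zero>"
      using P.Icarr by simp
    then show "p \<in> set_add R P P'"
      using p P'.zero_closed unfolding set_add_def' by blast
  qed
  moreover have "P' \<subseteq> P <+> P'"
  proof
    fix p assume p: "p \<in> P'"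
    then have "p = \<zero> \<oplus> p"
      using P'.Icarr by simp
    then show "p \<in> set_add R P P'"
      using p P.zero_closed unfolding set_add_def' by blast
  qed
  ultimately show ?thesis
    using P.I_maximal[OF J _ sub] P'.I_maximal[OF J _ sub] assms(3) by blast
qed

text \<open>Carries the theorem for a sequence of ideals \<open>J 0\<close>, ..., \<open>J n\<close>
  over to a finite set by enumerating it.\<close>

lemma (in cring) chinese_remainder_finite_set:
  assumes "finite \<Lambda>" and ideals: "\<And>P. P \<in> \<Lambda> \<Longrightarrow> ideal P R"
    and comax: "\<And>P P'. \<lbrakk>P \<in> \<Lambda>; P' \<in> \<Lambda>; P \<noteq> P'\<rbrakk> \<Longrightarrow> P <+> P' = carrier R"
    and x: "\<And>P. P \<in> \<Lambda> \<Longrightarrow> x P \<in> carrier R"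
  shows "\<exists>y\<in>carrier R. \<forall>P\<in>\<Lambda>. P +> y = P +> x P"
proof (cases "\<Lambda> = {}")
  case False
  \<comment> \<open>The bound \<open>n\<close> in \<open>canonical_proj_ext J n\<close> is
    inclusive, so it is one less than the number of ideals.\<close>
  then obtain n where n: "card \<Lambda> = Suc n"
    using assms(1) by (metis card_gt_0_iff gr0_implies_Suc)
  then obtain J where J: "bij_betw J {..<Suc n} \<Lambda>"
    using ex_bij_betw_nat_finite[OF assms(1)] by (auto simp: atLeast0LessThan)
  have mem: "J i \<in> \<Lambda>" if "i \<le> n" for i
    using J that by (auto simp: bij_betw_def)
  have "canonical_proj_ext J n ` carrier R =
      carrier (RDirProd_list (map (\<lambda>i. R Quot J i) [0..<Suc n]))"
  proof (rule canonical_proj_ext_is_surj)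
    fix i j assume ij: "i \<le> n" "j \<le> n" "i \<noteq> j"
    then have "J i \<noteq> J j"
      using J by (auto simp: bij_betw_def inj_on_def)
    then show "J i <+> J j = carrier R"
      using ij mem comax by blast
  qed (use ideals mem in auto)
  moreover have "map (\<lambda>i. J i +> x (J i)) [0..<Suc n] \<in>
      carrier (RDirProd_list (map (\<lambda>i. R Quot J i) [0..<Suc n]))"
  proof (rule RDirProd_list_carrier_memI, goal_cases)
    case (2 i)
    then have "map (\<lambda>i. R Quot J i) [0..<Suc n] ! i = R Quot J i"
      "map (\<lambda>i. J i +> x (J i)) [0..<Suc n] ! i = J i +> x (J i)"
      by (simp_all del: upt_Suc)
    then show ?case
      using 2 x[OF mem] by (auto simp: carrier_Quot simp del: upt_Suc)
  qed simp
  ultimately obtain y where y: "y \<in> carrier R"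
    "canonical_proj_ext J n y = map (\<lambda>i. J i +> x (J i)) [0..<Suc n]"
    by (metis (no_types, lifting) imageE)
  have "J i +> y = J i +> x (J i)" if "i \<le> n" for i
    using y(2) that by (auto simp: canonical_proj_ext_def simp del: upt_Suc)
  then have "\<forall>P\<in>\<Lambda>. P +> y = P +> x P"
    using J by (auto simp: bij_betw_def)
  then show ?thesis
    using y(1) by blast
qed auto

section \<open>Products of ideals\<close>

lemma (in cring) ideal_foldr_ideal_prod:
  assumes "\<forall>P\<in>set Ps. ideal P R"
  shows "ideal (foldr (ideal_prod R) Ps (carrier R)) R"
  using assms by (induction Ps) (auto intro: oneideal ideal_prod_is_ideal)

lemma (in cring) ideal_divides_foldr_ideal_prod:
  assumes "\<forall>P\<in>set Ps. ideal P R" "P \<in> set Ps"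
  shows "ideal_divides R P (foldr (ideal_prod R) Ps (carrier R))"
  using assms
proof (induction Ps)
  case (Cons P' Ps)
  let ?J = "foldr (ideal_prod R) Ps (carrier R)"
  have J: "ideal ?J R" and P': "ideal P' R"
    using Cons.prems ideal_foldr_ideal_prod by auto
  show ?case
  proof (cases "P = P'")
    case True
    then show ?thesis
      using J by (auto simp: ideal_divides_def)
  next
    case False
    then obtain L where L: "ideal L R" "?J = ideal_prod R P L"
      using Cons by (auto simp: ideal_divides_def)
    have P: "ideal P R"
      using Cons.prems by blast
    \<comment> \<open>Commutativity moves \<open>P\<close> to the front and leaves
      \<open>ideal_prod R P' L\<close> as the cofactor.\<close>
    have "ideal_prod R P' ?J = ideal_prod R P (ideal_prod R P' L)"
      using P P' L by (metis ideal_prod_assoc ideal_prod_commute)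
    then show ?thesis
      using ideal_prod_is_ideal[OF P' L(1)] by (auto simp: ideal_divides_def)
  qed
qed simp

text \<open>Multiply the equations of all factors: the product of the \<open>z\<close> lies in the
  product ideal, and every other term is a multiple of \<open>d\<close>. Repeated factors are
  covered too.\<close>

lemma (in cring) unit_mod_foldr_ideal_prod:
  assumes "\<forall>P\<in>set Ps. ideal P R" and d: "d \<in> carrier R"
    and "\<forall>P\<in>set Ps. \<exists>e\<in>carrier R. \<exists>z\<in>P. d \<otimes> e \<oplus> z = \<one>"
  shows "\<exists>e\<in>carrier R. \<exists>z\<in>foldr (ideal_prod R) Ps (carrier R). d \<otimes> e \<oplus> z = \<one>"
  using assms(1,3)
proof (induction Ps)
  case Nil
  show ?case
    \<comment> \<open>The empty product is the whole ring, so \<open>\<one>\<close> may serve as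
      \<open>z\<close>.\<close>
    using d by (intro bexI[of _ \<zero>] bexI[of _ \<one>]) auto
next
  case (Cons P Ps)
  let ?J = "foldr (ideal_prod R) Ps (carrier R)"
  have P: "ideal P R" and J: "ideal ?J R"
    using Cons.prems ideal_foldr_ideal_prod by auto
  obtain e z where e: "e \<in> carrier R" "z \<in> P" "d \<otimes> e \<oplus> z = \<one>"
    using Cons.prems by auto
  obtain e' z' where e': "e' \<in> carrier R" "z' \<in> ?J" "d \<otimes> e' \<oplus> z' = \<one>"
    using Cons by auto
  have z: "z \<in> carrier R" "z' \<in> carrier R"
    using e e' P J by (auto dest: ideal.Icarr)
  \<comment> \<open>The cofactor of \<open>d\<close> collects all terms of the expanded product
    except \<open>z \<otimes> z'\<close>.\<close>
  have "d \<otimes> (e \<otimes> (d \<otimes> e' \<oplus> z') \<oplus> z \<otimes> e') \<oplus> z \<otimes> z' = (d \<otimes> e \<oplus> z) \<otimes> (d \<otimes> e' \<oplus> z')"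
    using d e(1) e'(1) z by algebra
  then have "d \<otimes> (e \<otimes> (d \<otimes> e' \<oplus> z') \<oplus> z \<otimes> e') \<oplus> z \<otimes> z' = \<one>"
    using e(3) e'(3) by simp
  moreover have "z \<otimes> z' \<in> ideal_prod R P ?J"
    using e(2) e'(2) by (rule ideal_prod.prod)
  ultimately show ?case
    using d e(1) e'(1) z by (metis (no_types, lifting) a_closed foldr.simps(2) m_closed o_apply)
qed

section \<open>Residues modulo the prime divisors\<close>

lemma (in cring) prime_divisor_superset:
  assumes "P \<in> prime_divisors R I"
  shows "ideal P R" "I \<subseteq> P"
proof -
  show "ideal P R"
    using assms by (auto simp: prime_divisors_def dest: primeideal.axioms)
  then show "I \<subseteq> P"
    using assms ideal_prod_inter[of P] by (auto simp: prime_divisors_def ideal_divides_def)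
qed

text \<open>Since \<open>P\<close> absorbs \<open>I\<close>, adding \<open>P\<close> to a coset is
  the reduction map from \<open>R Quot I\<close> to \<open>R Quot P\<close>, written without
  choosing a representative.\<close>

lemma (in cring) set_add_coset:
  assumes "ideal I R" "ideal P R" "I \<subseteq> P" "x \<in> carrier R"
  shows "set_add R P (I +> x) = P +> x"
proof -
  interpret I: ideal I R by fact
  interpret P: ideal P R by fact
  have "P <+> I = P"
  proof
    show "P <+> I \<subseteq> P"
      using assms(3) by (auto simp: set_add_def')
    show "P \<subseteq> P <+> I"
    proof
      fix p assume "p \<in> P"
      then have "p = p \<oplus> \<zero>"
        using P.Icarr by simp
      then show "p \<in> P <+> I"
        using \<open>p \<in> P\<close> I.zero_closed unfolding set_add_def' by blast
    qed
  qed
  then show ?thesis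
    using a_setmult_rcos_assoc[OF P.a_subset I.a_subset assms(4)] by simp
qed

lemma (in cring) set_add_coset_image:
  assumes "ideal I R" "ideal P R" "I \<subseteq> P"
  shows "set_add R P ` carrier (R Quot I) = carrier (R Quot P)"
  using set_add_coset[OF assms] by (force simp: carrier_Quot image_image)

text \<open>An ideal containing \<open>I\<close> is a union of cosets of \<open>I\<close>, and there
  are only finitely many such unions.\<close>

lemma (in cring) finite_prime_divisors:
  assumes "ideal I R" "finite (carrier (R Quot I))"
  shows "finite (prime_divisors R I)"
proof -
  interpret I: ideal I R by fact
  have "P \<in> Union ` Pow (carrier (R Quot I))" if "P \<in> prime_divisors R I" for P
  proof -
    interpret P: ideal P R
      using prime_divisor_superset(1)[OF that] .
    have "P = \<Union> ((\<lambda>x. I +> x) ` P)"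
    proof
      show "P \<subseteq> \<Union> ((\<lambda>x. I +> x) ` P)"
        using I.a_rcos_self P.Icarr by blast
      show "\<Union> ((\<lambda>x. I +> x) ` P) \<subseteq> P"
        using prime_divisor_superset(2)[OF that] by (auto simp: a_r_coset_def')
    qed
    then show ?thesis
      using P.a_subset by (auto simp: carrier_Quot)
  qed
  then show ?thesis
    using assms(2) finite_subset[of _ "Union ` Pow (carrier (R Quot I))"] by blast
qed

section \<open>The Cayley graph in coordinates\<close>

text \<open>An inverse of the difference modulo \<open>I\<close> also works modulo each
  \<open>P\<close>, so a difference in \<open>P\<close> would put \<open>\<one>\<close> into
  \<open>P\<close>. Conversely, the equations for the prime factors of \<open>I\<close> multiply to
  one for \<open>I\<close>.\<close>

lemma (in dedekind_domain) unitary_cayley_graph_adjacent_iff: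
  assumes I: "ideal I R" "I \<noteq> {\<zero>}" "I \<noteq> carrier R" and fin: "finite (carrier (R Quot I))"
    and xy: "x \<in> carrier R" "y \<in> carrier R"
  shows "(I +> x, I +> y) \<in> parcs (unitary_cayley_graph (R Quot I)) \<longleftrightarrow>
    (\<forall>P\<in>prime_divisors R I. P +> x \<noteq> P +> y)"
proof -
  interpret I: ideal I R by fact
  interpret h: ring_hom_cring R "R Quot I" "(+>) I" by (rule I.rcos_ring_hom_cring[OF is_cring])
  have d: "x \<ominus> y \<in> carrier R"
    using xy by simp
  have "(I +> x) \<ominus>\<^bsub>R Quot I\<^esub> (I +> y) = I +> (x \<ominus> y)"
    using xy by (simp add: a_minus_def)
  then have "(I +> x, I +> y) \<in> parcs (unitary_cayley_graph (R Quot I)) \<longleftrightarrow>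
      I +> (x \<ominus> y) \<in> Units (R Quot I)"
    using xy by (simp add: unitary_cayley_graph_def)
  also have "\<dots> \<longleftrightarrow> (\<exists>e\<in>carrier R. \<exists>z\<in>I. (x \<ominus> y) \<otimes> e \<oplus> z = \<one>)"
    by (rule unit_mod_iff[OF I(1) d])
  also have "\<dots> \<longleftrightarrow> (\<forall>P\<in>prime_divisors R I. x \<ominus> y \<notin> P)"
  proof (intro iffI ballI notI)
    fix P assume ex: "\<exists>e\<in>carrier R. \<exists>z\<in>I. (x \<ominus> y) \<otimes> e \<oplus> z = \<one>"
      and P: "P \<in> prime_divisors R I" and xyP: "x \<ominus> y \<in> P"
    interpret P: primeideal P R
      using P by (simp add: prime_divisors_def)
    have "\<one> \<in> P"
      using ex xyP prime_divisor_superset(2)[OF P] by (metis P.I_r_closed P.a_closed subsetD)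
    then show False
      using P.one_imp_carrier P.I_notcarr by simp
  next
    assume notin: "\<forall>P\<in>prime_divisors R I. x \<ominus> y \<notin> P"
    obtain Ps where Ps: "\<forall>P\<in>set Ps. primeideal P R" "I = foldr (ideal_prod R) Ps (carrier R)"
      using prime_factorization I by blast
    have ideals: "\<forall>P\<in>set Ps. ideal P R"
      using Ps(1) by (auto dest: primeideal.axioms)
    have "\<exists>e\<in>carrier R. \<exists>z\<in>P. (x \<ominus> y) \<otimes> e \<oplus> z = \<one>" if "P \<in> set Ps" for P
    proof -
      have P: "P \<in> prime_divisors R I"
        using that Ps ideal_divides_foldr_ideal_prod[OF ideals] by (simp add: prime_divisors_def)
      have "finite (carrier (R Quot P))"
        using set_add_coset_image[OF I(1) prime_divisor_superset[OF P]] fin by (metis finite_imageI)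
      then show ?thesis
        using prime_unit_mod d notin P Ps(1) that by blast
    qed
    then show "\<exists>e\<in>carrier R. \<exists>z\<in>I. (x \<ominus> y) \<otimes> e \<oplus> z = \<one>"
      using unit_mod_foldr_ideal_prod[OF ideals d] Ps(2) by simp
  qed
  also have "\<dots> \<longleftrightarrow> (\<forall>P\<in>prime_divisors R I. P +> x \<noteq> P +> y)"
    using quotient_eq_iff_same_a_r_cos[OF prime_divisor_superset(1) xy] by auto
  finally show ?thesis .
qed

lemma (in dedekind_domain) coordinate_graph_unitary_cayley_graph:
  assumes I: "ideal I R" "I \<noteq> {\<zero>}" "I \<noteq> carrier R" and fin: "finite (carrier (R Quot I))"
  shows "coordinate_graph (unitary_cayley_graph (R Quot I)) (prime_divisors R I) (set_add R)"
proof -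
  let ?G = "unitary_cayley_graph (R Quot I)" and ?\<Lambda> = "prime_divisors R I"
  have verts: "pverts ?G = (\<lambda>x. I +> x) ` carrier R"
    by (simp add: unitary_cayley_graph_def carrier_Quot)
  have coord: "set_add R P (I +> x) = P +> x" if "P \<in> ?\<Lambda>" "x \<in> carrier R" for P x
    using set_add_coset[OF I(1) prime_divisor_superset[OF that(1)] that(2)] .
  have maximal: "maximalideal P R" if "P \<in> ?\<Lambda>" for P
  proof (rule finite_Quot_prime_maximal)
    show "primeideal P R"
      using that by (simp add: prime_divisors_def)
    show "finite (carrier (R Quot P))"
      using set_add_coset_image[OF I(1) prime_divisor_superset[OF that]] fin
      by (metis finite_imageI)
  qed
  show ?thesis
  proof
    show "finite (pverts ?G)"
      using fin by (simp add: unitary_cayley_graph_def)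
    show "pverts ?G \<noteq> {}"
      using verts by auto
    show "finite ?\<Lambda>"
      by (rule finite_prime_divisors[OF I(1) fin])
    obtain Ps where Ps: "\<forall>P\<in>set Ps. primeideal P R" "I = foldr (ideal_prod R) Ps (carrier R)"
      using prime_factorization I by blast
    \<comment> \<open>The empty product is \<open>carrier R\<close>, so a proper \<open>I\<close>
      has at least one prime factor.\<close>
    then have "Ps \<noteq> []"
      using I(3) by auto
    then have "hd Ps \<in> ?\<Lambda>"
      using Ps ideal_divides_foldr_ideal_prod[of Ps "hd Ps"]
      by (auto simp: prime_divisors_def dest: primeideal.axioms)
    then show "?\<Lambda> \<noteq> {}"
      by blast
  next
    fix A B assume "A \<in> pverts ?G" "B \<in> pverts ?G"
    then show "(A, B) \<in> parcs ?G \<longleftrightarrow> (\<forall>P\<in>?\<Lambda>. set_add R P A \<noteq> set_add R P B)"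
      using unitary_cayley_graph_adjacent_iff[OF I fin] verts coord by auto
  next
    fix c assume "\<And>P. P \<in> ?\<Lambda> \<Longrightarrow> c P \<in> pverts ?G"
    then have "\<forall>P\<in>?\<Lambda>. \<exists>x\<in>carrier R. c P = I +> x"
      unfolding verts by blast
    then obtain x where x: "\<And>P. P \<in> ?\<Lambda> \<Longrightarrow> x P \<in> carrier R" "\<And>P. P \<in> ?\<Lambda> \<Longrightarrow> c P = I +> x P"
      by metis
    have "\<exists>y\<in>carrier R. \<forall>P\<in>?\<Lambda>. P +> y = P +> x P"
      using finite_prime_divisors[OF I(1) fin] prime_divisor_superset(1)
        maximal_ideals_sum[OF maximal maximal] x(1)
      by (rule chinese_remainder_finite_set)
    then show "\<exists>A\<in>pverts ?G. \<forall>P\<in>?\<Lambda>. set_add R P A = set_add R P (c P)"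
      using x coord verts by auto
  qed
qed

text \<open>As \<open>I\<close> is not prime, \<open>P\<close> contains it properly. Shifting a
  representative by an element of \<open>P\<close> outside \<open>I\<close> changes its coset modulo
  \<open>I\<close> but not modulo \<open>P\<close>.\<close>

lemma (in dedekind_domain) distinct_cosets_agreeing:
  assumes I: "ideal I R" "\<not> primeideal I R" and P: "P \<in> prime_divisors R I"
    and A: "A \<in> carrier (R Quot I)"
  shows "\<exists>B\<in>carrier (R Quot I). B \<noteq> A \<and> set_add R P B = set_add R P A"
proof -
  note P' = prime_divisor_superset[OF P]
  interpret I: ideal I R by fact
  interpret P: ideal P R by fact
  obtain x where x: "x \<in> carrier R" "A = I +> x"
    using A by (auto simp: carrier_Quot)
  have "P \<noteq> I"
    using P I(2) by (auto simp: prime_divisors_def)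
  then obtain p where p: "p \<in> P" "p \<notin> I"
    using P'(2) by blast
  have y: "p \<oplus> x \<in> carrier R"
    using p(1) x(1) by simp
  have "(p \<oplus> x) \<ominus> x = p"
    using P.Icarr[OF p(1)] x(1) by algebra
  then have "I +> (p \<oplus> x) \<noteq> I +> x" "P +> (p \<oplus> x) = P +> x"
    using quotient_eq_iff_same_a_r_cos[OF I(1) y x(1)]
      quotient_eq_iff_same_a_r_cos[OF P'(1) y x(1)] p by auto
  then show ?thesis
    using set_add_coset[OF I(1) P'] x y by (auto simp: carrier_Quot)
qed

text \<open>The quotient is a finite domain, so every nonzero difference is invertible.\<close>

lemma (in cring) complete_unitary_cayley_graph_prime:
  assumes "primeideal I R" "finite (carrier (R Quot I))"
  shows "clique (unitary_cayley_graph (R Quot I)) (carrier (R Quot I))"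
proof -
  interpret I: primeideal I R by fact
  interpret Q: "domain" "R Quot I" by (rule I.quotient_is_domain)
  have "A \<ominus>\<^bsub>R Quot I\<^esub> B \<in> Units (R Quot I)"
    if XY: "A \<in> carrier (R Quot I)" "B \<in> carrier (R Quot I)" "A \<noteq> B" for A B
  proof -
    have "A \<ominus>\<^bsub>R Quot I\<^esub> B \<noteq> \<zero>\<^bsub>R Quot I\<^esub>"
      using XY by (simp add: Q.r_right_minus_eq)
    moreover have closed: "A \<ominus>\<^bsub>R Quot I\<^esub> B \<in> carrier (R Quot I)"
      using XY by simp
    ultimately obtain C where "C \<in> carrier (R Quot I)"
        "(A \<ominus>\<^bsub>R Quot I\<^esub> B) \<otimes>\<^bsub>R Quot I\<^esub> C = \<one>\<^bsub>R Quot I\<^esub>"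
      using Q.finite_right_inverse[OF assms(2)] by blast
    then show ?thesis
      using closed Q.m_comm unfolding Units_def by fastforce
  qed
  then show ?thesis
    by (auto simp: clique_def unitary_cayley_graph_def)
qed

section \<open>Computation of the clique domination number\<close>

theorem theorem4p5:
  fixes R :: "('a, 'b) ring_scheme" (structure) and I :: "'a set"
  assumes "dedekind_domain R"
    and "ideal I R"
    and "I \<noteq> {\<zero>}"
    and "finite (carrier (R Quot I))"
    and "carrier (R Quot I) \<noteq> {\<zero>\<^bsub>R Quot I\<^esub>}"
  defines "G \<equiv> unitary_cayley_graph (R Quot I)"
  shows "(primeideal I R \<longrightarrow> clique_domination_number G = Some 1)
    \<and> (\<not> primeideal I R \<and> Q R I > lam R I \<longrightarrow>
         clique_domination_number G = Some (lam R I + 1))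
    \<and> (\<not> primeideal I R \<and> Q R I \<le> lam R I \<longrightarrow>
         clique_domination_number G = None)
    \<and> (\<forall>k K. clique_domination_number G = Some k \<and> clique G K \<and> card K = k \<longrightarrow>
         dominating G K)"
proof -
  interpret dedekind_domain R by fact
  have proper: "I \<noteq> carrier R"
  proof
    assume "I = carrier R"
    then have "I +> x = I" if "x \<in> carrier R" for x
      using coset_eq_zero_iff[OF assms(2) that] that by simp
    then have "carrier (R Quot I) = {\<zero>\<^bsub>R Quot I\<^esub>}"
      using zero_closed unfolding carrier_Quot by (force simp: FactRing_def)
    with assms(5) show False ..
  qed
  have verts: "pverts G = carrier (R Quot I)"
    by (simp add: G_def unitary_cayley_graph_def)
  let ?\<Lambda> = "prime_divisors R I"
  interpret coordinate_graph G ?\<Lambda> "set_add R"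
    unfolding G_def
    by (rule coordinate_graph_unitary_cayley_graph[OF assms(2,3) proper assms(4)])
  show ?thesis
  proof (cases "primeideal I R")
    case True
    have complete: "clique G (pverts G)"
      unfolding verts unfolding G_def by (rule complete_unitary_cayley_graph_prime[OF True assms(4)])
    have one: "clique_domination_number G = Some 1"
      by (rule complete_graph_clique_domination_number[OF complete verts_ne finite_verts])
    \<comment> \<open>Cardinality 1 makes \<open>K\<close> nonempty, which suffices in a complete
      graph.\<close>
    have "dominating G K" if "clique G K" "card K = 1" for K
      using that by (intro complete_graph_dominating[OF complete]) (auto simp: clique_def)
    then show ?thesis
      using True one by simp
  next
    case False
    have agree: "\<exists>B\<in>pverts G. B \<noteq> A \<and> (\<exists>P\<in>?\<Lambda>. set_add R P B = set_add R P A)"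
      if A: "A \<in> pverts G" for A
    proof -
      obtain P where P: "P \<in> ?\<Lambda>"
        using coords_ne by blast
      show ?thesis
        using distinct_cosets_agreeing[OF assms(2) False P] A P unfolding verts by metis
    qed
    \<comment> \<open>Reduction modulo \<open>P\<close> is onto, so \<open>Q R I\<close> is the
      least number of values taken by a coordinate.\<close>
    have residues: "card (set_add R P ` pverts G) = card (carrier (R Quot P))" if "P \<in> ?\<Lambda>" for P
      using set_add_coset_image[OF assms(2) prime_divisor_superset[OF that]] by (simp add: verts)
    have some: "clique_domination_number G = Some (lam R I + 1)" if "Q R I > lam R I"
      unfolding lam_def
    proof (rule clique_domination_number_Some[OF agree])
      fix P assume P: "P \<in> ?\<Lambda>"
      then have "Q R I \<le> card (carrier (R Quot P))"
        unfolding Q_def using finite_coords by (intro Min_le) auto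
      then show "card ?\<Lambda> < card (set_add R P ` pverts G)"
        using that residues[OF P] by (simp add: lam_def)
    qed
    have none: "clique_domination_number G = None" if le: "Q R I \<le> lam R I"
    proof -
      have "Q R I \<in> (\<lambda>P. card (carrier (R Quot P))) ` ?\<Lambda>"
        unfolding Q_def using finite_coords coords_ne by (intro Min_in) auto
      then obtain P where "P \<in> ?\<Lambda>" "card (carrier (R Quot P)) \<le> card ?\<Lambda>"
        using le by (auto simp: lam_def)
      then show ?thesis
        using clique_domination_number_None[OF agree] residues by metis
    qed
    \<comment> \<open>If the number exists, \<open>none\<close> excludes a small
      \<open>Q R I\<close>, and \<open>some\<close> makes \<open>k\<close> one more than
      \<open>lam R I\<close>, just enough for the pigeonhole argument.\<close>
    have "dominating G K"
      if "clique_domination_number G = Some k" "clique G K" "card K = k" for k K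
    proof (rule clique_card_gt_dominating)
      show "card K > card ?\<Lambda>"
        using that some none by (cases "Q R I > lam R I") (auto simp: lam_def)
    qed fact
    then show ?thesis
      using False some none by blast
  qed
qed

end
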